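(* Let $S$ be a semigroup, let $\sigma: S\to S$ be an involutive automorphism and let $\tau: S\to S$ be an involutive anti-automorphism. Let $f: S\to\mathbb{C}$ be a non-zero solution of the functional equation $$f(x\sigma(y))+f(\tau(y)x)=2f(x)f(y)\quad\text{for all }x,y\in S.$$ Then $$f(\sigma(a)\sigma(x)\sigma(y))+f(\sigma(a)\sigma(y)\sigma(x))=2f(\sigma(a))f(yx)+2f(x)f(\sigma(a)\sigma(y))+2f(\sigma(a)\sigma(x))f(y)-4f(\sigma(a))f(x)f(y)$$ for all $a,x,y\in S$.
   Context: $\sigma$ being an involutive automorphism means $\sigma(xy)=\sigma(x)\sigma(y)$ and $\sigma(\sigma(x))=x$ for all $x,y\in S$; $\tau$ being an involutive anti-automorphism means $\tau(xy)=\tau(y)\tau(x)$ and $\tau(\tau(x))=x$ for all $x,y\in S$. Non-zero means not identically zero. *)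

theory Defs
  imports Complex_Main
begin

definition involutive_automorphism :: "('a::semigroup_mult \<Rightarrow> 'a) \<Rightarrow> bool" where
  "involutive_automorphism \<sigma> \<longleftrightarrow>
     (\<forall>x y. \<sigma> (x * y) = \<sigma> x * \<sigma> y) \<and> (\<forall>x. \<sigma> (\<sigma> x) = x)"

definition involutive_anti_automorphism :: "('a::semigroup_mult \<Rightarrow> 'a) \<Rightarrow> bool" where
  "involutive_anti_automorphism \<tau> \<longleftrightarrow>
     (\<forall>x y. \<tau> (x * y) = \<tau> y * \<tau> x) \<and> (\<forall>x. \<tau> (\<tau> x) = x)"

end

theory Submission
  imports Defs
begin

text \<open>
  Write \<open>b = \<sigma> a\<close>, \<open>X = \<sigma> x\<close>, \<open>Y = \<sigma> y\<close>. The functional equation trades a factor \<open>\<sigma> z\<close> on the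
  right for a factor \<open>\<tau> z\<close> on the left, with a change of sign. Moving \<open>Y\<close> and then \<open>X\<close> of \<open>b X Y\<close>
  across \<open>b\<close> one at a time ends at \<open>\<tau> x \<tau> y b\<close>; moving the product \<open>Y X = \<sigma> (y x)\<close> of \<open>b Y X\<close>
  across at once ends at \<open>\<tau> (y x) b\<close>. Since \<open>\<tau>\<close> reverses products, these are the same element, and
  it is reached with opposite signs, so it cancels from the sum of \<open>f (b X Y)\<close> and \<open>f (b Y X)\<close>.
\<close>

theorem proposition3p2:
  fixes \<sigma> \<tau> :: "'a::semigroup_mult \<Rightarrow> 'a" and f :: "'a \<Rightarrow> complex"
  assumes "involutive_automorphism \<sigma>"
    and "involutive_anti_automorphism \<tau>"
    and "\<exists>x. f x \<noteq> 0"
    and "\<forall>x y. f (x * \<sigma> y) + f (\<tau> y * x) = 2 * f x * f y"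
  shows "\<forall>a x y. f (\<sigma> a * \<sigma> x * \<sigma> y) + f (\<sigma> a * \<sigma> y * \<sigma> x)
    = 2 * f (\<sigma> a) * f (y * x) + 2 * f x * f (\<sigma> a * \<sigma> y)
      + 2 * f (\<sigma> a * \<sigma> x) * f y - 4 * f (\<sigma> a) * f x * f y"
proof (intro allI)
  fix a x y
  define b where "b = \<sigma> a"
  have \<sigma>_mult: "\<sigma> (y * x) = \<sigma> y * \<sigma> x"
    using assms(1) by (simp add: involutive_automorphism_def)
  have \<tau>_mult: "\<tau> (y * x) = \<tau> x * \<tau> y"
    using assms(2) by (simp add: involutive_anti_automorphism_def)
  have swap: "f (u * \<sigma> z) = 2 * f u * f z - f (\<tau> z * u)" for u z
    using assms(4) by (simp add: eq_diff_eq)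
  have "f (b * \<sigma> x * \<sigma> y) = 2 * f (b * \<sigma> x) * f y - f (\<tau> y * b * \<sigma> x)"
    using swap[of "b * \<sigma> x" y] by (simp add: mult.assoc)
  also have "f (\<tau> y * b * \<sigma> x) = 2 * f (\<tau> y * b) * f x - f (\<tau> x * \<tau> y * b)"
    using swap[of "\<tau> y * b" x] by (simp add: mult.assoc)
  also have "f (\<tau> y * b) = 2 * f b * f y - f (b * \<sigma> y)"
    using swap[of b y] by simp
  finally have one_by_one: "f (b * \<sigma> x * \<sigma> y) =
      2 * f (b * \<sigma> x) * f y
        - (2 * (2 * f b * f y - f (b * \<sigma> y)) * f x - f (\<tau> x * \<tau> y * b))" .
  have at_once: "f (b * \<sigma> y * \<sigma> x) = 2 * f b * f (y * x) - f (\<tau> x * \<tau> y * b)"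
    using swap[of b "y * x"] by (simp add: \<sigma>_mult \<tau>_mult mult.assoc)
  show "f (\<sigma> a * \<sigma> x * \<sigma> y) + f (\<sigma> a * \<sigma> y * \<sigma> x)
    = 2 * f (\<sigma> a) * f (y * x) + 2 * f x * f (\<sigma> a * \<sigma> y)
      + 2 * f (\<sigma> a * \<sigma> x) * f y - 4 * f (\<sigma> a) * f x * f y"
    unfolding b_def[symmetric] one_by_one at_once by (simp add: algebra_simps)
qed

end
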